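(* Let $(\mathcal L;\leq,\odot,1)$ be a non-trivial q.n.c. tomonoid, let $F$ be a non-trivial Archimedean filter of $\mathcal L$ such that each $F$-class is order-isomorphic to a real interval, and let $\mathcal P$ be the quotient of $\mathcal L$ by $F$. Let $F$ have a smallest element. Let $R,T\in\mathcal P$, where $T<F$, be a $\odot$-maximal pair, let $S=R\odot T$, and assume that neither $R$ nor $S$ is a singleton. Then $\Lambda^R$ and $\Lambda^S$ are Łukasiewicz and, under the identification of $R$ and $S$ with $[0,1]$, there is some $m\in\bigl[-\frac{\alpha_S}{\alpha_R},\,(1-\frac{\alpha_S}{\alpha_R})\wedge 0\bigr]$ such that $\Lambda^{R,S}$ consists exactly of the mappings \[ \lambda_z\colon[0,1]\to[0,1],\quad r\mapsto\Bigl(\tfrac{\alpha_S}{\alpha_R}\,r+z\Bigr)\vee 0,\qquad -\tfrac{\alpha_S}{\alpha_R}\leq z\leq m. \]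
   Context: For reals, $\wedge,\vee$ denote minimum and maximum. Tomonoids. A tomonoid is a structure $(\mathcal L;\leq,\odot,1)$ where $(\mathcal L;\odot,1)$ is a monoid and $\leq$ is a total order such that $a\leq b$, $c\leq d$ imply $a\odot c\leq b\odot d$. It is commutative if $\odot$ is; negative if $a\leq 1$ for all $a$; quantic if every non-empty subset has a supremum and $a\odot\bigvee_\iota b_\iota=\bigvee_\iota(a\odot b_\iota)$, $(\bigvee_\iota b_\iota)\odot a=\bigvee_\iota(b_\iota\odot a)$ for all $a$ and all non-empty families $(b_\iota)$. "q.n.c." means quantic, negative, commutative. A tomonoid is trivial if it consists of $1$ alone. It is Archimedean if for all $a<b<1$ there is $n\geq1$ with $b^n\leq a$. Filters and quotients. A filter of $\mathcal L$ is a subset $F\ni 1$ closed under $\odot$ and upward closed, regarded as a tomonoid with the restricted structure; it is non-trivial if $F\neq\{1\}$. The congruence induced by $F$: $a\sim_F b$ iff $a=b$, or $a<b$ and $b\odot f\leq a$ for some $f\in F$, or $b<a$ and $a\odot f\leq b$ for some $f\in F$. Its classes, which are intervals of $\mathcal L$, are the $F$-classes; the quotient $\mathcal P$ of $\mathcal L$ by $F$ is the set of $F$-classes, ordered by $R\leq S$ iff $a\leq b$ for some $a\in R,b\in S$, with the induced product $\odot$ and identity (top element) $F$; it is again q.n.c. A real interval is a singleton or a set $(a,b),(a,b],[a,b)$ or $[a,b]$ with $a<b$ in $\mathbb R$. A pair $R,T\in\mathcal P$ with $S=R\odot T$ is $\odot$-maximal if $R$ is the largest $X\in\mathcal P$ with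 $X\odot T=S$ and $T$ is the largest $Y\in\mathcal P$ with $R\odot Y=S$. Translations. For $a\in\mathcal L$ let $\lambda_a\colon\mathcal L\to\mathcal L$, $x\mapsto a\odot x$. For an $F$-class $R$ and $f\in F$, let $\lambda_f^R\colon R\to R$ be the restriction of $\lambda_f$; $\Lambda^R=\{\lambda^R_f : f\in F\}$, and $\varrho_R\colon F\to\Lambda^R$, $f\mapsto\lambda^R_f$. For $F$-classes $R,T$ with $T\neq F$ and $S=R\odot T$, let $\lambda_t^{R,S}\colon R\to S$ be the restriction of $\lambda_t$ ($t\in T$), and $\Lambda^{R,S}=\{\lambda_t^{R,S}:t\in T\}$. Composition tomonoids. A composition tomonoid on a chain $R$ is a set $\Phi$ of order-preserving maps $R\to R$ that is totally ordered by the pointwise order, closed under composition, and contains $\mathrm{id}_R$. $\Phi$ on $R$ and $\Psi$ on $S$ are c-isomorphic if there is an order isomorphism $\phi\colon R\to S$ with $\Psi=\{\phi\circ\lambda\circ\phi^{-1}:\lambda\in\Phi\}$. A composition tomonoid is called Łukasiewicz if it is c-isomorphic to $\Phi^{\text{Łu}}=\{[0,1]\to[0,1],\,x\mapsto(x+t-1)\vee0 : t\in[0,1]\}$. Identifications and coefficients. Since $F$ has a smallest element, $F$ is isomorphic as a tomonoid to $([0,1];\leq,\star,1)$ with $a\star b=(a+b-1)\vee0$ (known fact); $F$ is identified with $[0,1]$ by such an isomorphism. For each non-singleton $F$-class $Q$, $\Lambda^Q$ is then Łukasiewicz; $Q$ is identified with $[0,1]$ by means of an order isomorphism that is a c-isomorphism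 from $\Lambda^Q$ to $\Phi^{\text{Łu}}$; and there is a coefficient $\alpha_Q\geq1$ such that under these identifications $\varrho_Q(f)(r)=(r+\alpha_Q(f-1))\vee0$ for $f\in F$, $r\in[0,1]$. The numbers $\alpha_R$ and $\alpha_S$ are these coefficients for $Q=R$ and $Q=S$. *)

theory Defs
  imports Complex_Main "HOL-Library.FuncSet"
begin

section \<open>Tomonoids\<close>

class tomonoid = linorder + monoid_mult +
  assumes tomonoid_mult_mono: "a \<le> b \<Longrightarrow> c \<le> d \<Longrightarrow> a * c \<le> b * d"

class negative_tomonoid = tomonoid +
  assumes tomonoid_le_one: "a \<le> 1"

class commutative_tomonoid = tomonoid + comm_monoid_mult

definition (in ord) is_sup :: "'a set \<Rightarrow> 'a \<Rightarrow> bool" where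
  "is_sup A s \<longleftrightarrow> (\<forall>a\<in>A. a \<le> s) \<and> (\<forall>u. (\<forall>a\<in>A. a \<le> u) \<longrightarrow> s \<le> u)"

class quantic_tomonoid = tomonoid +
  assumes ex_is_sup: "A \<noteq> {} \<Longrightarrow> \<exists>s. is_sup A s"
    and is_sup_mult_left: "A \<noteq> {} \<Longrightarrow> is_sup A s \<Longrightarrow> is_sup ((\<lambda>b. a * b) ` A) (a * s)"
    and is_sup_mult_right: "A \<noteq> {} \<Longrightarrow> is_sup A s \<Longrightarrow> is_sup ((\<lambda>b. b * a) ` A) (s * a)"

class qnc_tomonoid = quantic_tomonoid + negative_tomonoid + commutative_tomonoid


section \<open>Chains\<close>

definition order_iso :: "('a::order \<Rightarrow> 'b::order) \<Rightarrow> 'a set \<Rightarrow> 'b set \<Rightarrow> bool" where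
  "order_iso \<phi> A B \<longleftrightarrow> bij_betw \<phi> A B \<and> (\<forall>x\<in>A. \<forall>y\<in>A. x \<le> y \<longleftrightarrow> \<phi> x \<le> \<phi> y)"

definition order_isomorphic :: "'a::order set \<Rightarrow> 'b::order set \<Rightarrow> bool" where
  "order_isomorphic A B \<longleftrightarrow> (\<exists>\<phi>. order_iso \<phi> A B)"

definition real_interval :: "real set \<Rightarrow> bool" where
  "real_interval I \<longleftrightarrow> (\<exists>a. I = {a}) \<or>
     (\<exists>a b. a < b \<and> (I = {a<..<b} \<or> I = {a<..b} \<or> I = {a..<b} \<or> I = {a..b}))"


section \<open>Filters and quotients\<close>

definition tomonoid_filter :: "'a::tomonoid set \<Rightarrow> bool" where
  "tomonoid_filter F \<longleftrightarrow> 1 \<in> F \<and> (\<forall>a\<in>F. \<forall>b\<in>F. a * b \<in> F) \<and> (\<forall>a\<in>F. \<forall>b. a \<le> b \<longrightarrow> b \<in> F)"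

definition archimedean :: "'a::tomonoid set \<Rightarrow> bool" where
  "archimedean F \<longleftrightarrow> (\<forall>a\<in>F. \<forall>b\<in>F. a < b \<and> b < 1 \<longrightarrow> (\<exists>n\<ge>1. b ^ n \<le> a))"

definition filter_cong :: "'a::tomonoid set \<Rightarrow> ('a \<times> 'a) set" where
  "filter_cong F = {(a, b). a = b \<or> (a < b \<and> (\<exists>f\<in>F. b * f \<le> a)) \<or> (b < a \<and> (\<exists>f\<in>F. a * f \<le> b))}"

definition filter_quotient :: "'a::tomonoid set \<Rightarrow> 'a set set" where
  "filter_quotient F = UNIV // filter_cong F"

definition quot_le :: "'a::tomonoid set \<Rightarrow> 'a set \<Rightarrow> bool" where
  "quot_le R S \<longleftrightarrow> (\<exists>a\<in>R. \<exists>b\<in>S. a \<le> b)"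

definition quot_less :: "'a::tomonoid set \<Rightarrow> 'a set \<Rightarrow> bool" where
  "quot_less R S \<longleftrightarrow> quot_le R S \<and> R \<noteq> S"

text \<open>The induced product of two classes is the class containing all products of their
  elements, here obtained as the saturation of the elementwise product.\<close>

definition quot_mult :: "'a::tomonoid set \<Rightarrow> 'a set \<Rightarrow> 'a set \<Rightarrow> 'a set" where
  "quot_mult F R T = filter_cong F `` {r * t | r t. r \<in> R \<and> t \<in> T}"

definition maximal_pair :: "'a::tomonoid set \<Rightarrow> 'a set \<Rightarrow> 'a set \<Rightarrow> bool" where
  "maximal_pair F R T \<longleftrightarrow> R \<in> filter_quotient F \<and> T \<in> filter_quotient F \<and>
     (\<forall>X\<in>filter_quotient F. quot_mult F X T = quot_mult F R T \<longrightarrow> quot_le X R) \<and>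
     (\<forall>Y\<in>filter_quotient F. quot_mult F R Y = quot_mult F R T \<longrightarrow> quot_le Y T)"


section \<open>Translations\<close>

text \<open>Maps with domain \<open>R\<close> are represented as extensional functions on \<open>R\<close>. With this
  convention \<open>translation R f\<close> is \<open>\<lambda>\<^sub>f\<^sup>R\<close> (so \<open>translation R\<close> restricted to \<open>F\<close> is \<open>\<rho>\<^sub>R\<close>),
  \<open>translation_set F R\<close> is \<open>\<Lambda>\<^sup>R\<close>, and \<open>translation_set T R\<close> is \<open>\<Lambda>\<^bsup>R,S\<^esup>\<close> for \<open>S\<close> the product
  of \<open>R\<close> and \<open>T\<close>.\<close>

definition translation :: "'a::tomonoid set \<Rightarrow> 'a \<Rightarrow> 'a \<Rightarrow> 'a" where
  "translation R a = (\<lambda>x\<in>R. a * x)"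

definition translation_set :: "'a::tomonoid set \<Rightarrow> 'a set \<Rightarrow> ('a \<Rightarrow> 'a) set" where
  "translation_set A R = translation R ` A"


section \<open>Composition tomonoids\<close>

definition composition_tomonoid :: "'a::linorder set \<Rightarrow> ('a \<Rightarrow> 'a) set \<Rightarrow> bool" where
  "composition_tomonoid R \<Phi> \<longleftrightarrow>
     \<Phi> \<subseteq> R \<rightarrow>\<^sub>E R \<and>
     (\<forall>f\<in>\<Phi>. mono_on R f) \<and>
     (\<forall>f\<in>\<Phi>. \<forall>g\<in>\<Phi>. (\<forall>x\<in>R. f x \<le> g x) \<or> (\<forall>x\<in>R. g x \<le> f x)) \<and>
     (\<forall>f\<in>\<Phi>. \<forall>g\<in>\<Phi>. compose R f g \<in> \<Phi>) \<and>
     (\<lambda>x\<in>R. x) \<in> \<Phi>"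

text \<open>\<open>transport R S \<phi> \<psi> f\<close> is \<open>\<psi> \<circ> f \<circ> \<phi>\<^sup>-\<^sup>1\<close>, for a bijection \<open>\<phi>\<close> of \<open>R\<close> onto the set \<open>S\<close>.\<close>

definition transport ::
  "'a set \<Rightarrow> 'b set \<Rightarrow> ('a \<Rightarrow> 'b) \<Rightarrow> ('c \<Rightarrow> 'd) \<Rightarrow> ('a \<Rightarrow> 'c) \<Rightarrow> 'b \<Rightarrow> 'd" where
  "transport R S \<phi> \<psi> f = (\<lambda>y\<in>S. \<psi> (f (inv_into R \<phi> y)))"

definition c_iso ::
  "('a::linorder \<Rightarrow> 'b::linorder) \<Rightarrow> 'a set \<Rightarrow> ('a \<Rightarrow> 'a) set \<Rightarrow> 'b set \<Rightarrow> ('b \<Rightarrow> 'b) set \<Rightarrow> bool" where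
  "c_iso \<phi> R \<Phi> S \<Psi> \<longleftrightarrow> order_iso \<phi> R S \<and> \<Psi> = transport R S \<phi> \<phi> ` \<Phi>"

definition Phi_Luk :: "(real \<Rightarrow> real) set" where
  "Phi_Luk = {(\<lambda>x\<in>{0..1}. max (x + t - 1) 0) | t. t \<in> {0..1}}"

definition lukasiewicz :: "'a::linorder set \<Rightarrow> ('a \<Rightarrow> 'a) set \<Rightarrow> bool" where
  "lukasiewicz R \<Phi> \<longleftrightarrow> composition_tomonoid R \<Phi> \<and> (\<exists>\<phi>. c_iso \<phi> R \<Phi> {0..1} Phi_Luk)"


section \<open>Identifications and coefficients\<close>

definition filter_identification :: "'a::tomonoid set \<Rightarrow> ('a \<Rightarrow> real) \<Rightarrow> bool" where
  "filter_identification F \<iota> \<longleftrightarrow> order_iso \<iota> F {0..1} \<and> \<iota> 1 = 1 \<and>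
     (\<forall>a\<in>F. \<forall>b\<in>F. \<iota> (a * b) = max (\<iota> a + \<iota> b - 1) 0)"

text \<open>Given the identification \<open>\<iota>\<close> of \<open>F\<close> with the unit interval, \<open>\<phi>\<close> is an admissible
  identification of the class \<open>Q\<close> with the unit interval, and \<open>\<alpha>\<close> is the coefficient of \<open>Q\<close>.\<close>

definition class_identification ::
  "'a::tomonoid set \<Rightarrow> ('a \<Rightarrow> real) \<Rightarrow> 'a set \<Rightarrow> ('a \<Rightarrow> real) \<Rightarrow> real \<Rightarrow> bool" where
  "class_identification F \<iota> Q \<phi> \<alpha> \<longleftrightarrow>
     c_iso \<phi> Q (translation_set F Q) {0..1} Phi_Luk \<and> \<alpha> \<ge> 1 \<and>
     (\<forall>f\<in>F. \<forall>r\<in>{0..1}.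
        transport Q {0..1} \<phi> \<phi> (translation Q f) r = max (r + \<alpha> * (\<iota> f - 1)) 0)"

end

theory Submission
  imports Defs
begin

text \<open>
  Let \<open>u\<close> be the least element of \<open>F\<close>. It is idempotent, so \<open>a\<close> and \<open>b\<close> are congruent iff
  \<open>a * u = b * u\<close>, and every class has \<open>x * u\<close> as its least element (\<open>filter_cong_iff\<close>).

  Preservation of suprema and the Archimedean property together make the action of \<open>F\<close> by
  multiplication rigid. It is divisible: every element between \<open>b * u\<close> and \<open>b\<close> has the form
  \<open>b * f\<close> with \<open>f \<in> F\<close> (\<open>mult_residual\<close>). It is cancellative above the bottom: \<open>b * f = b * g\<close>
  with \<open>f < g\<close> forces \<open>b * g = b * u\<close> (\<open>mult_cancel\<close>). The same argument provides square roots
  in \<open>F\<close>.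

  An argument in the manner of Hoelder then identifies \<open>F\<close> with the unit interval: iterated square
  roots \<open>e n\<close> of some element between \<open>u\<close> and \<open>1\<close> tend to \<open>1\<close>, and the number of factors \<open>e n\<close>
  needed to get below \<open>a\<close>, divided by \<open>2 ^ n\<close>, converges to a truncated additive measure of the
  distance of \<open>a\<close> from \<open>1\<close> (\<open>depth\<close>).

  Every class is the orbit \<open>v * F\<close> of its largest element \<open>v\<close> (\<open>class_eq_orbit\<close>). Up to order
  isomorphism this is an upper segment \<open>[k, 1]\<close> of \<open>F\<close>, where \<open>k\<close> is the largest element with
  \<open>v * k = v * u\<close>; rescaling the segment to the unit interval yields the identification of the
  class, with coefficient \<open>1 / (1 - k)\<close> (\<open>ex_class_identification\<close>).

  Finally, let \<open>w\<close> be the largest element of \<open>T\<close>. Translation by \<open>w\<close> commutes with the action of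
  \<open>F\<close>, which has slope \<open>\<alpha>\<^sub>R\<close> in the coordinate of \<open>R\<close> and \<open>\<alpha>\<^sub>S\<close> in that of \<open>S\<close>; hence it is affine
  with slope \<open>\<alpha>\<^sub>S / \<alpha>\<^sub>R\<close>, truncated at \<open>0\<close>, and it maps bottom to bottom, so that its constant term
  \<open>m\<close> is not positive (\<open>translation_affine\<close>). Since \<open>T = w * F\<close>, the other translations arise
  from this one by lowering the constant term by \<open>\<alpha>\<^sub>S * (1 - f)\<close>, and all values between \<open>m\<close> and
  \<open>- \<alpha>\<^sub>S / \<alpha>\<^sub>R\<close>, where the map becomes constantly \<open>0\<close>, are attained.\<close>


section \<open>Monotonicity of powers and suprema\<close>

lemma negative_mult_le:
  fixes a b :: "'a::qnc_tomonoid"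
  shows "a * b \<le> a" and "b * a \<le> a"
  using tomonoid_mult_mono[of a a b 1] tomonoid_le_one[of b] by (simp_all add: mult.commute)

lemma tomonoid_power_antimono:
  fixes a :: "'a::qnc_tomonoid"
  assumes "m \<le> n"
  shows "a ^ n \<le> a ^ m"
  using assms by (metis le_add_diff_inverse negative_mult_le(1) power_add)

lemma is_sup_upper: "is_sup A s \<Longrightarrow> a \<in> A \<Longrightarrow> a \<le> s"
  by (simp add: is_sup_def)

lemma is_sup_least: "is_sup A s \<Longrightarrow> (\<And>a. a \<in> A \<Longrightarrow> a \<le> x) \<Longrightarrow> s \<le> x"
  by (simp add: is_sup_def)

lemma less_is_sup:
  fixes s :: "'a::linorder"
  shows "is_sup A s \<Longrightarrow> x < s \<Longrightarrow> \<exists>a\<in>A. x < a"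
  by (meson is_sup_least leD not_le_imp_less)


section \<open>Divisibility and cancellation in a bounded Archimedean filter\<close>

text \<open>An Archimedean filter with a least element \<open>u \<noteq> 1\<close> and a dense order. The completeness
  of \<open>F\<close> is inherited from the surrounding tomonoid. All multiplications \<open>b * f\<close> below, with
  \<open>f \<in> F\<close> and \<open>b\<close> an arbitrary element of the tomonoid, are viewed as an action of \<open>F\<close>.\<close>

locale bounded_archimedean_filter =
  fixes F :: "'a::qnc_tomonoid set" and u :: 'a
  assumes filter: "tomonoid_filter F"
    and arch: "archimedean F"
    and u_in: "u \<in> F"
    and u_least: "f \<in> F \<Longrightarrow> u \<le> f"
    and u_less_one: "u < 1"
    and dense_F: "f \<in> F \<Longrightarrow> g \<in> F \<Longrightarrow> f < g \<Longrightarrow> \<exists>h. f < h \<and> h < g"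
begin

lemma one_in: "1 \<in> F"
  and mult_in: "f \<in> F \<Longrightarrow> g \<in> F \<Longrightarrow> f * g \<in> F"
  and up_in: "f \<in> F \<Longrightarrow> f \<le> a \<Longrightarrow> a \<in> F"
  using filter by (auto simp: tomonoid_filter_def)

lemma power_in: "f \<in> F \<Longrightarrow> f ^ n \<in> F"
  by (induction n) (auto intro: one_in mult_in)

lemma mult_u: "f \<in> F \<Longrightarrow> f * u = u" "f \<in> F \<Longrightarrow> u * f = u"
  by (metis antisym mult_in negative_mult_le(1) negative_mult_le(2) u_in u_least mult.commute)+

lemma nilpotent:
  assumes "z \<in> F" "z < 1"
  shows "\<exists>n. z ^ n = u"
proof (cases "z = u")
  case True
  then show ?thesis by (intro exI[of _ 1]) simp
next
  case False
  then have "u < z" using u_least[OF assms(1)] by simp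
  then obtain n where "z ^ n \<le> u"
    using arch assms u_in unfolding archimedean_def by blast
  then show ?thesis using u_least[OF power_in[OF assms(1)]] by (metis antisym)
qed

text \<open>Left-continuity at the identity: multiplication by elements close to \<open>1\<close> moves
  an element by arbitrarily little.\<close>

lemma approach:
  assumes "x < a"
  shows "\<exists>y\<in>F. y < 1 \<and> x < a * y"
proof -
  let ?Y = "{y \<in> F. y < 1}"
  have ne: "?Y \<noteq> {}" using u_in u_less_one by auto
  have "1 \<le> w" if w: "\<forall>y\<in>?Y. y \<le> w" for w
  proof (rule ccontr)
    assume "\<not> 1 \<le> w"
    then have "w < 1" by simp
    have "w \<in> F" using w u_in u_less_one by (auto intro: up_in)
    then obtain c where "w < c" "c < 1" using dense_F[OF _ one_in \<open>w < 1\<close>] by blast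
    moreover have "c \<in> F" using \<open>w \<in> F\<close> \<open>w < c\<close> up_in by (meson less_imp_le)
    ultimately show False using w by fastforce
  qed
  then have "is_sup ?Y 1" by (auto simp: is_sup_def)
  then have "is_sup ((\<lambda>b. a * b) ` ?Y) a"
    using is_sup_mult_left[OF ne, of 1 a] by simp
  from less_is_sup[OF this assms] show ?thesis by auto
qed

text \<open>The powers of \<open>z\<close> descend from \<open>1\<close> to \<open>u\<close>, so some step leads from above \<open>d\<close> to
  \<open>d\<close> or below.\<close>

lemma step_across:
  assumes "z \<in> F" "z < 1" "d \<in> F" "d < 1"
  shows "\<exists>x\<in>F. d < x \<and> x * z \<le> d"
proof -
  obtain n where "z ^ n = u" using nilpotent assms by blast
  then have ex: "\<exists>n. z ^ n \<le> d" using u_least assms by metis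
  define k where "k = (LEAST n. z ^ n \<le> d)"
  have k: "z ^ k \<le> d" unfolding k_def using ex by (rule LeastI_ex)
  have "k \<noteq> 0" using k assms by (metis not_le power_0)
  then obtain j where j: "k = Suc j" by (cases k) auto
  have "d < z ^ j"
    using not_less_Least[of j "\<lambda>n. z ^ n \<le> d"] j by (auto simp: k_def)
  then show ?thesis using k j power_in[OF assms(1)] by (metis power_Suc2)
qed

text \<open>The residual \<open>b \<rightarrow> a\<close> of the action of \<open>F\<close>: the largest \<open>f \<in> F\<close> with \<open>b * f \<le> a\<close>. It is
  meaningful if \<open>b * u \<le> a\<close>; the maximum then exists because multiplication preserves suprema.\<close>

definition residual :: "'a \<Rightarrow> 'a \<Rightarrow> 'a" where
  "residual b a = (GREATEST f. f \<in> F \<and> b * f \<le> a)"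

lemma
  assumes "b * u \<le> a"
  shows residual_in: "residual b a \<in> F"
    and residual_le: "b * residual b a \<le> a"
    and residual_greatest: "\<And>f. f \<in> F \<Longrightarrow> b * f \<le> a \<Longrightarrow> f \<le> residual b a"
proof -
  let ?X = "{f \<in> F. b * f \<le> a}"
  have ne: "?X \<noteq> {}" using assms u_in by auto
  obtain s where s: "is_sup ?X s" using ex_is_sup[OF ne] by blast
  have "is_sup ((\<lambda>f. b * f) ` ?X) (b * s)" using is_sup_mult_left[OF ne s] .
  then have le: "b * s \<le> a" by (rule is_sup_least) auto
  have ub: "f \<in> F \<Longrightarrow> b * f \<le> a \<Longrightarrow> f \<le> s" for f using is_sup_upper[OF s] by auto
  have sF: "s \<in> F" using ub[OF u_in assms] up_in[OF u_in] by blast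
  have "residual b a = s" unfolding residual_def
    by (rule Greatest_equality) (use le ub sF in auto)
  then show "residual b a \<in> F" "b * residual b a \<le> a"
    "\<And>f. f \<in> F \<Longrightarrow> b * f \<le> a \<Longrightarrow> f \<le> residual b a"
    using le ub sF by auto
qed

text \<open>Divisibility. Let \<open>d\<close> be the residual. If \<open>b * d < a\<close>, the map \<open>f \<mapsto> b * f\<close> jumps from
  \<open>b * d\<close> to above \<open>a\<close> right after \<open>d\<close>. Choose \<open>y\<close> so close to \<open>1\<close> that \<open>b * d < a * y\<close>. A power
  \<open>x\<close> of \<open>y\<close> with \<open>x * y \<le> d < x\<close> yields \<open>a * y \<le> b * x * y \<le> b * d\<close>, a contradiction.\<close>

lemma mult_residual:
  assumes "b * u \<le> a" "a \<le> b"
  shows "b * residual b a = a"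
proof (rule ccontr)
  let ?d = "residual b a"
  assume "b * ?d \<noteq> a"
  then have lt: "b * ?d < a" using residual_le[OF assms(1)] by simp
  then have d1: "?d < 1" using assms tomonoid_le_one[of ?d] by (cases "?d = 1") auto
  obtain y where y: "y \<in> F" "y < 1" "b * ?d < a * y" using approach[OF lt] by blast
  obtain x where x: "x \<in> F" "?d < x" "x * y \<le> ?d"
    using step_across[OF y(1,2) residual_in[OF assms(1)] d1] by blast
  have "a \<le> b * x"
    using residual_greatest[OF assms(1) x(1)] x(2) by (meson leD le_cases)
  then have "a * y \<le> b * x * y" by (simp add: tomonoid_mult_mono)
  also have "\<dots> \<le> b * ?d" using tomonoid_mult_mono[OF order_refl x(3)] by (simp add: mult.assoc)
  finally show False using y(3) by simp
qed

lemma fixed_imp_bottom: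
  assumes "h \<in> F" "h < 1" "x * h = x"
  shows "x = x * u"
proof -
  obtain n where n: "h ^ n = u" using nilpotent assms by blast
  have "x * h ^ n = x" for n by (induction n) (auto simp: assms(3) mult.assoc[symmetric])
  then show ?thesis using n by metis
qed

lemma mult_cancel:
  assumes "f \<in> F" "g \<in> F" "f < g" "r * f = r * g"
  shows "r * g = r * u"
proof -
  have le: "g * u \<le> f" using mult_u u_least assms by simp
  let ?h = "residual g f"
  have h: "?h \<in> F" "g * ?h = f"
    using residual_in[OF le] mult_residual[OF le] assms(3) by auto
  then have "?h < 1" using assms(3) tomonoid_le_one[of ?h] by (cases "?h = 1") auto
  moreover have "(r * g) * ?h = r * g" using h(2) assms(4) by (simp add: mult.assoc)
  ultimately have "r * g = r * g * u" using fixed_imp_bottom h(1) by blast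
  then show ?thesis using mult_u(1)[OF assms(2)] by (simp add: mult.assoc)
qed

text \<open>The supremum \<open>s\<close> of all elements whose square is below \<open>a\<close> is a square root of \<open>a\<close>: that
  squaring does not jump over \<open>a\<close> at \<open>s\<close> is shown as in the proof of divisibility.\<close>

lemma ex_square_root:
  assumes "a \<in> F"
  shows "\<exists>x\<in>F. x * x = a"
proof -
  let ?X = "{x \<in> F. x * x \<le> a}"
  have ne: "?X \<noteq> {}" using mult_u(1)[OF u_in] u_least[OF assms] u_in by force
  obtain s where s: "is_sup ?X s" using ex_is_sup[OF ne] by blast
  have sF: "s \<in> F" using ne is_sup_upper[OF s] up_in by blast
  have "x * y \<le> a" if "x \<in> ?X" "y \<in> ?X" for x y
  proof (cases "x \<le> y")
    case True
    then have "x * y \<le> y * y" by (simp add: tomonoid_mult_mono)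
    then show ?thesis using that by auto
  next
    case False
    then have "x * y \<le> x * x" by (simp add: tomonoid_mult_mono)
    then show ?thesis using that by auto
  qed
  then have "x * s \<le> a" if "x \<in> ?X" for x
    using is_sup_least[OF is_sup_mult_left[OF ne s, of x], of a] that by blast
  then have le: "s * s \<le> a"
    using is_sup_least[OF is_sup_mult_right[OF ne s, of s], of a] by blast
  have "s * s = a"
  proof (rule ccontr)
    assume "s * s \<noteq> a"
    then have lt: "s * s < a" using le by simp
    then have s1: "s < 1" using tomonoid_le_one[of a] tomonoid_le_one[of s] by (cases "s = 1") auto
    obtain y where y: "y \<in> F" "y < 1" "s * s < a * y" using approach[OF lt] by blast
    obtain z where z: "z \<in> F" "z < 1" "y \<le> z * z"
    proof -
      obtain z1 where z1: "y < z1" "z1 < 1" using dense_F[OF y(1) one_in y(2)] by blast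
      obtain w where w: "w \<in> F" "w < 1" "y < z1 * w" using approach[OF z1(1)] by blast
      have "z1 * w \<le> max z1 w * max z1 w" by (simp add: tomonoid_mult_mono)
      then show ?thesis using z1 w that[of "max z1 w"] up_in[OF w(1), of "max z1 w"] by auto
    qed
    obtain x where x: "x \<in> F" "s < x" "x * z \<le> s"
      using step_across[OF z(1,2) sF s1] by blast
    have "a < x * x" using x is_sup_upper[OF s, of x] by fastforce
    have "a * y \<le> (x * x) * (z * z)" using \<open>a < x * x\<close> z(3) by (simp add: tomonoid_mult_mono)
    also have "\<dots> = (x * z) * (x * z)" by (simp add: mult_ac)
    also have "\<dots> \<le> s * s" using x(3) by (simp add: tomonoid_mult_mono)
    finally show False using y(3) by simp
  qed
  then show ?thesis using sF by blast
qed

end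


section \<open>The filter is isomorphic to the unit interval\<close>

text \<open>A sequence of iterated square roots, strictly between \<open>u\<close> and \<open>1\<close>; its members serve as
  units of measurement.\<close>

locale root_sequence = bounded_archimedean_filter +
  fixes e :: "nat \<Rightarrow> 'a"
  assumes e_in: "e n \<in> F"
    and e_gt: "u < e n"
    and e_lt: "e n < 1"
    and e_square: "e (Suc n) * e (Suc n) = e n"
begin

lemma e_double: "e (Suc n) ^ (2 * m) = e n ^ m"
  by (simp add: power_mult power2_eq_square e_square)

text \<open>The supremum of the roots is idempotent, hence equal to \<open>1\<close>.\<close>

lemma less_root:
  assumes "f \<in> F" "f < 1"
  shows "\<exists>n. f < e n"
proof -
  obtain s where s: "is_sup (range e) s" using ex_is_sup[of "range e"] by blast
  have es: "e n \<le> s" for n using is_sup_upper[OF s] by blast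
  have "e n \<le> s * s" for n
    using tomonoid_mult_mono[OF es[of "Suc n"] es[of "Suc n"]] by (simp add: e_square)
  then have "s \<le> s * s" using is_sup_least[OF s, of "s * s"] by blast
  then have ss: "s * s = s" using negative_mult_le(1)[of s s] by simp
  have sF: "s \<in> F" using es e_in up_in by blast
  have "s = 1"
  proof (rule ccontr)
    assume "s \<noteq> 1"
    then have "s < 1" using tomonoid_le_one[of s] by simp
    then have "s = u" using fixed_imp_bottom[OF sF _ ss] mult_u(1)[OF sF] by simp
    then show False using es[of 0] e_gt[of 0] by simp
  qed
  then show ?thesis using less_is_sup[OF s] assms(2) by auto
qed

text \<open>\<open>steps n a\<close> measures the distance of \<open>a\<close> from \<open>1\<close>: it is the number of factors \<open>e n\<close>
  needed to get to \<open>a\<close> or below.\<close>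

definition steps :: "nat \<Rightarrow> 'a \<Rightarrow> nat" where
  "steps n a = (LEAST m. e n ^ m \<le> a)"

lemma steps_le_iff:
  assumes "a \<in> F"
  shows "steps n a \<le> k \<longleftrightarrow> e n ^ k \<le> a"
proof
  obtain m where "e n ^ m = u" using nilpotent[OF e_in e_lt] by blast
  then have "e n ^ m \<le> a" using u_least[OF assms] by simp
  then have "e n ^ steps n a \<le> a" unfolding steps_def by (rule LeastI)
  moreover assume "steps n a \<le> k"
  ultimately show "e n ^ k \<le> a" using tomonoid_power_antimono by (metis order_trans)
next
  assume "e n ^ k \<le> a"
  then show "steps n a \<le> k" unfolding steps_def by (rule Least_le)
qed

lemma steps_pred:
  assumes "a \<in> F"
  shows "a \<le> e n ^ (steps n a - 1)"
proof (cases "steps n a")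
  case 0
  then show ?thesis by (simp add: tomonoid_le_one)
next
  case (Suc k)
  then show ?thesis using steps_le_iff[OF assms, of n k] by auto
qed

lemma steps_Suc_le:
  assumes "a \<in> F"
  shows "steps (Suc n) a \<le> 2 * steps n a"
  by (simp add: steps_le_iff assms e_double) (simp add: steps_le_iff[symmetric] assms)

lemma steps_le_Suc:
  assumes "a \<in> F"
  shows "2 * steps n a \<le> steps (Suc n) a + 1"
proof -
  let ?k = "(steps (Suc n) a + 1) div 2"
  have "steps (Suc n) a \<le> 2 * ?k" by simp
  then have "steps n a \<le> ?k"
    unfolding steps_le_iff[OF assms] e_double .
  then show ?thesis by simp
qed

lemma steps_mult_le:
  assumes "a \<in> F" "b \<in> F"
  shows "steps n (a * b) \<le> steps n a + steps n b"
  unfolding steps_le_iff[OF mult_in[OF assms]] power_add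
  by (rule tomonoid_mult_mono) (simp_all add: steps_le_iff[symmetric] assms)

lemma steps_mult_ge:
  assumes "a \<in> F" "b \<in> F" "a * b \<noteq> u"
  shows "steps n a + steps n b \<le> steps n (a * b) + 2"
proof (rule ccontr)
  let ?k = "steps n (a * b)"
  have ab: "a * b \<in> F" using assms mult_in by blast
  assume "\<not> ?thesis"
  then have k: "?k + 1 \<le> (steps n a - 1) + (steps n b - 1)" by linarith
  have "a * b \<le> e n ^ (steps n a - 1) * e n ^ (steps n b - 1)"
    by (intro tomonoid_mult_mono steps_pred assms)
  also have "\<dots> \<le> e n ^ (?k + 1)"
    unfolding power_add[symmetric] using k by (rule tomonoid_power_antimono)
  also have "\<dots> \<le> (a * b) * e n"
    using steps_le_iff[OF ab, of n ?k] by (simp add: mult.commute tomonoid_mult_mono)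
  finally have "(a * b) * e n = a * b" using negative_mult_le(1) by (metis antisym)
  then show False using fixed_imp_bottom[OF e_in e_lt] mult_u(1)[OF ab] assms(3) by metis
qed

text \<open>The distance of \<open>a\<close> from \<open>1\<close> as a real number, in the unit of \<open>e 0\<close>, as \<open>e n\<close> accounts for
  the \<open>2 ^ n\<close>-th part of this unit. The limit exists because the quotients decrease. The unit is
  arbitrary; the identification with the unit interval divides by \<open>depth u\<close>.\<close>

definition depth :: "'a \<Rightarrow> real" where
  "depth a = lim (\<lambda>n. real (steps n a) / 2 ^ n)"

lemma
  assumes "a \<in> F"
  shows depth_lim: "(\<lambda>n. real (steps n a) / 2 ^ n) \<longlonglongrightarrow> depth a"
    and depth_le: "depth a \<le> real (steps n a) / 2 ^ n"
    and depth_ge: "(real (steps n a) - 1) / 2 ^ n \<le> depth a"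
proof -
  have "real (steps (Suc n) a) / 2 ^ Suc n \<le> real (steps n a) / 2 ^ n" for n
    using steps_Suc_le[OF assms, of n] by (simp add: field_simps)
  then have dec: "decseq (\<lambda>n. real (steps n a) / 2 ^ n)" by (rule decseq_SucI)
  obtain L where L: "(\<lambda>n. real (steps n a) / 2 ^ n) \<longlonglongrightarrow> L"
    "\<And>n. L \<le> real (steps n a) / 2 ^ n"
    using decseq_convergent[OF dec, of 0] by auto
  then have eq: "depth a = L" unfolding depth_def by (simp add: limI)
  have "(\<lambda>n. (1 / 2) ^ n :: real) \<longlonglongrightarrow> 0" by (rule LIMSEQ_power_zero) simp
  from tendsto_diff[OF L(1) this]
  have lim: "(\<lambda>n. (real (steps n a) - 1) / 2 ^ n) \<longlonglongrightarrow> L"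
    by (simp add: power_one_over diff_divide_distrib inverse_eq_divide)
  have "(real (steps n a) - 1) / 2 ^ n \<le> (real (steps (Suc n) a) - 1) / 2 ^ Suc n" for n
  proof -
    have "(2 * real (steps n a) - 2) / 2 ^ Suc n \<le> (real (steps (Suc n) a) - 1) / 2 ^ Suc n"
      using steps_le_Suc[OF assms, of n] by (intro divide_right_mono) auto
    then show ?thesis by (simp add: diff_divide_distrib)
  qed
  then have inc: "incseq (\<lambda>n. (real (steps n a) - 1) / 2 ^ n)" by (rule incseq_SucI)
  show "(\<lambda>n. real (steps n a) / 2 ^ n) \<longlonglongrightarrow> depth a"
    "depth a \<le> real (steps n a) / 2 ^ n"
    "(real (steps n a) - 1) / 2 ^ n \<le> depth a"
    using L eq incseq_le[OF inc lim] by auto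
qed

lemma depth_one: "depth 1 = 0"
proof -
  have "steps n 1 = 0" for n using steps_le_iff[OF one_in, of n 0] by simp
  then show ?thesis by (simp add: depth_def)
qed

lemma depth_pos:
  assumes "f \<in> F" "f < 1"
  shows "0 < depth f"
proof -
  obtain n where "f < e n" using less_root assms by blast
  then have "\<not> steps n f \<le> 1" by (simp add: steps_le_iff assms)
  then have "0 < (real (steps n f) - 1) / 2 ^ n" by simp
  then show ?thesis using depth_ge[OF assms(1), of n] by linarith
qed

lemma depth_nonneg: "f \<in> F \<Longrightarrow> 0 \<le> depth f"
  using depth_pos[of f] depth_one tomonoid_le_one[of f] by (cases "f = 1") (auto simp: less_le)

lemma depth_antimono:
  assumes "a \<in> F" "b \<in> F" "a \<le> b"
  shows "depth b \<le> depth a"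
proof (rule LIMSEQ_le[OF depth_lim[OF assms(2)] depth_lim[OF assms(1)]])
  have "steps n b \<le> steps n a" for n
    unfolding steps_le_iff[OF assms(2)]
    using assms(3) steps_le_iff[OF assms(1), of n "steps n a"] by simp
  then show "\<exists>N. \<forall>n\<ge>N. real (steps n b) / 2 ^ n \<le> real (steps n a) / 2 ^ n"
    by (simp add: divide_right_mono)
qed

lemma depth_mult_le:
  assumes "a \<in> F" "b \<in> F"
  shows "depth (a * b) \<le> depth a + depth b"
proof (rule LIMSEQ_le[OF depth_lim[OF mult_in[OF assms]]
      tendsto_add[OF depth_lim[OF assms(1)] depth_lim[OF assms(2)]]])
  have "real (steps n (a * b)) \<le> real (steps n a) + real (steps n b)" for n
    using steps_mult_le[OF assms, of n] by linarith
  then show "\<exists>N. \<forall>n\<ge>N. real (steps n (a * b)) / 2 ^ n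
      \<le> real (steps n a) / 2 ^ n + real (steps n b) / 2 ^ n"
    by (simp add: add_divide_distrib[symmetric] divide_right_mono)
qed

lemma depth_mult_eq:
  assumes "a \<in> F" "b \<in> F" "a * b \<noteq> u"
  shows "depth (a * b) = depth a + depth b"
proof (rule antisym[OF depth_mult_le[OF assms(1,2)]])
  have "(\<lambda>n. (1 / 2) ^ n :: real) \<longlonglongrightarrow> 0" by (rule LIMSEQ_power_zero) simp
  from tendsto_add[OF depth_lim[OF mult_in[OF assms(1,2)]] tendsto_mult_left[OF this, of 2]]
  have lim: "(\<lambda>n. real (steps n (a * b)) / 2 ^ n + 2 * (1 / 2) ^ n) \<longlonglongrightarrow> depth (a * b)"
    by simp
  have "real (steps n a) + real (steps n b) \<le> real (steps n (a * b)) + 2" for n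
    using steps_mult_ge[OF assms, of n] by linarith
  then have "real (steps n a) / 2 ^ n + real (steps n b) / 2 ^ n
      \<le> real (steps n (a * b)) / 2 ^ n + 2 * (1 / 2) ^ n" for n
    by (simp add: power_one_over add_divide_distrib[symmetric] divide_right_mono)
  then show "depth a + depth b \<le> depth (a * b)"
    by (intro LIMSEQ_le[OF tendsto_add[OF depth_lim[OF assms(1)] depth_lim[OF assms(2)]] lim]) blast
qed

text \<open>Additivity up to truncation at the depth of the bottom element.\<close>

lemma depth_mult:
  assumes "a \<in> F" "b \<in> F"
  shows "depth (a * b) = min (depth a + depth b) (depth u)"
proof (cases "a * b = u")
  case True
  then show ?thesis using depth_mult_le[OF assms] by simp
next
  case False
  then show ?thesis
    using depth_mult_eq[OF assms] depth_antimono[OF u_in mult_in[OF assms] u_least[OF mult_in[OF assms]]]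
    by simp
qed

lemma depth_strict_antimono:
  assumes "a \<in> F" "b \<in> F" "a < b"
  shows "depth b < depth a"
proof -
  \<comment> \<open>Additivity gives strictness directly only above \<open>u\<close>; density covers the case \<open>a = u\<close>.\<close>
  have *: "depth b < depth c" if c: "c \<in> F" "c < b" "c \<noteq> u" for c
  proof -
    have le: "b * u \<le> c" using mult_u(1)[OF assms(2)] u_least c by simp
    have h: "residual b c \<in> F" "b * residual b c = c"
      using residual_in[OF le] mult_residual[OF le] c by auto
    then have "residual b c < 1" using c tomonoid_le_one[of "residual b c"]
      by (cases "residual b c = 1") auto
    then show ?thesis using depth_mult_eq[OF assms(2) h(1)] depth_pos[OF h(1)] h(2) c by simp
  qed
  obtain c where c: "a < c" "c < b" using dense_F assms by blast
  then have "c \<in> F" "c \<noteq> u" using up_in[OF assms(1)] u_least[OF assms(1)] by auto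
  then show ?thesis using *[of c] depth_antimono[OF assms(1), of c] c by (meson less_imp_le order.strict_trans2)
qed

lemma depth_le_iff:
  assumes "a \<in> F" "b \<in> F"
  shows "depth b \<le> depth a \<longleftrightarrow> a \<le> b"
  using depth_antimono[OF assms] depth_strict_antimono[OF assms(2,1)] by force

lemma depth_power:
  assumes "f \<in> F"
  shows "depth (f ^ m) = min (real m * depth f) (depth u)"
proof (induction m)
  case 0
  then show ?case using depth_one depth_nonneg[OF u_in] by simp
next
  case (Suc m)
  show ?case
    using depth_mult[OF assms power_in[OF assms], of m] Suc depth_nonneg[OF assms]
      depth_nonneg[OF u_in]
    by (simp add: algebra_simps min_def)
qed

lemma small_root:
  assumes "0 < \<epsilon>"
  shows "\<exists>n. depth (e n) < \<epsilon>"
proof -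
  obtain n where n: "(1 / 2) ^ n < \<epsilon>"
    using real_arch_pow_inv[OF assms, of "1 / 2"] by auto
  have "steps n (e n) \<le> 1" by (simp add: steps_le_iff e_in)
  then have "real (steps n (e n)) / 2 ^ n \<le> (1 / 2) ^ n"
    by (simp add: power_one_over divide_right_mono)
  then show ?thesis using depth_le[OF e_in, of n n] n by (intro exI[of _ n]) linarith
qed

lemma depth_values_dense:
  assumes "0 \<le> x" "x < y" "y \<le> depth u"
  shows "\<exists>a\<in>F. x < depth a \<and> depth a \<le> y"
proof -
  obtain n where n: "depth (e n) < y - x" using small_root[of "y - x"] assms by auto
  let ?d = "depth (e n)"
  have d: "0 < ?d" by (simp add: depth_pos e_in e_lt)
  have "0 \<le> y / ?d" using d assms by simp
  then obtain m :: nat where "real m \<le> y / ?d" "y / ?d < real m + 1"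
    using that[of "nat \<lfloor>y / ?d\<rfloor>"] by linarith
  then have "real m * ?d \<le> y" "y < real m * ?d + ?d" using d by (simp_all add: field_simps)
  then have "x < depth (e n ^ m) \<and> depth (e n ^ m) \<le> y"
    using n assms by (simp add: depth_power e_in)
  then show ?thesis using power_in[OF e_in] by blast
qed

lemma depth_surj:
  assumes "0 \<le> t" "t \<le> depth u"
  shows "\<exists>a\<in>F. depth a = t"
proof -
  let ?X = "{x \<in> F. t \<le> depth x}"
  have uX: "u \<in> ?X" using assms u_in by simp
  then obtain s where s: "is_sup ?X s" using ex_is_sup[of ?X] by blast
  have sF: "s \<in> F" using is_sup_upper[OF s uX] up_in[OF u_in] by blast
  have "\<not> t < depth s"
  proof
    assume "t < depth s"
    then obtain a where a: "a \<in> F" "t < depth a" "depth a \<le> (t + depth s) / 2"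
      using depth_values_dense[of t "(t + depth s) / 2"] assms
        depth_antimono[OF u_in sF u_least[OF sF]] by fastforce
    then have "depth s \<le> depth a" using is_sup_upper[OF s, of a] depth_le_iff[OF a(1) sF] by simp
    then show False using a \<open>t < depth s\<close> by simp
  qed
  moreover have "\<not> depth s < t"
  proof
    assume "depth s < t"
    then obtain a where a: "a \<in> F" "depth s < depth a" "depth a \<le> t"
      using depth_values_dense[of "depth s" t] assms depth_nonneg[OF sF] by auto
    then have "a < s" using depth_le_iff[OF sF a(1)] by force
    then obtain x where "x \<in> ?X" "a < x" using less_is_sup[OF s] by blast
    then show False using depth_strict_antimono[OF a(1), of x] a(3) by auto
  qed
  ultimately show ?thesis using sF by force
qed

lemma root_filter_identification:
  "filter_identification F (\<lambda>a. 1 - depth a / depth u)"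
proof -
  let ?\<iota> = "\<lambda>a. 1 - depth a / depth u"
  have pos: "0 < depth u" by (simp add: depth_pos u_in u_less_one)
  have le: "depth f \<le> depth u" if "f \<in> F" for f
    using depth_antimono[OF u_in that u_least[OF that]] .
  have mono: "x \<le> y \<longleftrightarrow> ?\<iota> x \<le> ?\<iota> y" if "x \<in> F" "y \<in> F" for x y
    using pos depth_le_iff[OF that] by (simp add: divide_le_cancel)
  then have "inj_on ?\<iota> F" by (intro inj_onI) (metis antisym order_refl)
  moreover have "?\<iota> ` F = {0..1}"
  proof
    show "?\<iota> ` F \<subseteq> {0..1}" using pos le depth_nonneg by auto
    show "{0..1} \<subseteq> ?\<iota> ` F"
    proof
      fix y :: real assume y: "y \<in> {0..1}"
      then obtain a where "a \<in> F" "depth a = (1 - y) * depth u"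
        using depth_surj[of "(1 - y) * depth u"] pos by (auto simp: mult_le_cancel_right1)
      then show "y \<in> ?\<iota> ` F" using pos by (intro image_eqI[of _ _ a]) auto
    qed
  qed
  moreover have "?\<iota> (a * b) = max (?\<iota> a + ?\<iota> b - 1) 0" if "a \<in> F" "b \<in> F" for a b
  proof (cases "depth a + depth b \<le> depth u")
    case True
    then have "(depth a + depth b) / depth u \<le> 1" using pos by simp
    then show ?thesis using True by (simp add: depth_mult that add_divide_distrib)
  next
    case False
    then have "1 \<le> (depth a + depth b) / depth u" using pos by simp
    then show ?thesis using False pos by (simp add: depth_mult that add_divide_distrib)
  qed
  ultimately show ?thesis using mono depth_one
    by (simp add: filter_identification_def order_iso_def bij_betw_def)
qed

end

context bounded_archimedean_filter
begin

lemma ex_filter_identification: "\<exists>\<iota>. filter_identification F \<iota>"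
proof -
  let ?P = "\<lambda>x. x \<in> F \<and> u < x \<and> x < 1"
  obtain w where "u < w" "w < 1" using dense_F[OF u_in one_in u_less_one] by blast
  then have base: "?P w" using up_in[OF u_in] by auto
  have step: "\<exists>y. ?P y \<and> y * y = x" if x: "?P x" for x
  proof -
    obtain y where y: "y \<in> F" "y * y = x" using ex_square_root[of x] x by blast
    then have "y \<noteq> u" "y \<noteq> 1" using x mult_u[OF u_in] by auto
    then show ?thesis using y u_least[OF y(1)] tomonoid_le_one[of y] by force
  qed
  obtain e where "\<forall>n. ?P (e n) \<and> e (Suc n) * e (Suc n) = e n"
    using dependent_nat_choice[of "\<lambda>_. ?P" "\<lambda>_ x y. y * y = x"] base step by auto
  then interpret root_sequence F u e by unfold_locales auto
  show ?thesis using root_filter_identification by blast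
qed

end

section \<open>Classes as orbits of the filter\<close>

context bounded_archimedean_filter
begin

text \<open>Since \<open>u\<close> is the least element of the filter and idempotent, multiplication by \<open>u\<close>
  selects the least element of each class.\<close>

lemma filter_cong_iff: "(a, b) \<in> filter_cong F \<longleftrightarrow> a * u = b * u"
proof -
  have *: "(\<exists>f\<in>F. y * f \<le> x) \<longleftrightarrow> x * u = y * u" if "x < y" for x y
  proof
    assume "\<exists>f\<in>F. y * f \<le> x"
    then obtain f where f: "f \<in> F" "y * f \<le> x" by blast
    have "y * u = (y * f) * u" using mult_u(1)[OF f(1)] by (simp add: mult.assoc)
    also have "\<dots> \<le> x * u" using f(2) by (simp add: tomonoid_mult_mono)
    finally show "x * u = y * u" using that by (simp add: antisym tomonoid_mult_mono)
  next
    assume "x * u = y * u"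
    then show "\<exists>f\<in>F. y * f \<le> x" using u_in negative_mult_le(1)[of x u] by metis
  qed
  show ?thesis
    using *[of a b] *[of b a] by (cases a b rule: linorder_cases) (auto simp: filter_cong_def)
qed

lemma filter_quotient_iff: "Q \<in> filter_quotient F \<longleftrightarrow> (\<exists>a. Q = {x. x * u = a * u})"
proof -
  have "filter_cong F `` {a} = {x. x * u = a * u}" for a by (auto simp: filter_cong_iff)
  then show ?thesis by (auto simp: filter_quotient_def quotient_def)
qed

lemma class_mult_closed:
  assumes "Q \<in> filter_quotient F" "f \<in> F" "x \<in> Q"
  shows "f * x \<in> Q"
proof -
  have "f * x * u = x * u" using mult_u[OF assms(2)] by (metis mult.assoc mult.commute)
  then show ?thesis using assms(1,3) by (auto simp: filter_quotient_iff)
qed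

text \<open>The supremum of a class belongs to the class, and by divisibility the filter carries
  it to every other element of the class.\<close>

lemma class_eq_orbit:
  assumes "Q \<in> filter_quotient F"
  shows "\<exists>v. Q = (\<lambda>f. v * f) ` F"
proof -
  obtain a where a: "Q = {x. x * u = a * u}" using assms filter_quotient_iff by blast
  then have ne: "Q \<noteq> {}" by blast
  obtain v where v: "is_sup Q v" using ex_is_sup[OF ne] by blast
  have "is_sup ((\<lambda>b. b * u) ` Q) (v * u)" using is_sup_mult_right[OF ne v] .
  moreover have "(\<lambda>b. b * u) ` Q = {a * u}" using a ne by auto
  ultimately have vu: "v * u = a * u" by (simp add: is_sup_def antisym)
  have "x \<in> (\<lambda>f. v * f) ` F" if "x \<in> Q" for x
  proof -
    have le: "v * u \<le> x" using that a vu negative_mult_le(1)[of x u] by simp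
    then show ?thesis
      using mult_residual[OF le is_sup_upper[OF v that]] residual_in[OF le] by force
  qed
  moreover have "v * f \<in> Q" if "f \<in> F" for f
    using that a vu mult_u(1) by (simp add: mult.assoc)
  ultimately show ?thesis by blast
qed

text \<open>The residual inverts \<open>f \<mapsto> v * f\<close>, except that all elements mapped to the bottom \<open>v * u\<close>
  are collapsed to the largest of them.\<close>

lemma residual_orbit:
  assumes "f \<in> F"
  shows "residual v (v * f) = max f (residual v (v * u))"
proof -
  let ?k = "residual v (v * u)"
  have vuf: "v * u \<le> v * f" using u_least[OF assms] by (simp add: tomonoid_mult_mono)
  have k: "?k \<in> F" "v * ?k \<le> v * u" using residual_in residual_le by simp_all
  let ?g = "residual v (v * f)"
  have g: "?g \<in> F" "v * ?g = v * f"
    using residual_in[OF vuf] mult_residual[OF vuf negative_mult_le(1)] by auto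
  have "max f ?k \<le> ?g"
    using residual_greatest[OF vuf assms] residual_greatest[OF vuf k(1)] k(2) vuf
    by (meson max.boundedI order_refl order_trans)
  moreover have "?g \<le> max f ?k"
  proof (cases "?g \<le> f")
    case False
    then have "v * ?g = v * u" using mult_cancel[OF assms g(1)] g(2) by simp
    then have "?g \<le> ?k" using residual_greatest[of v "v * u" ?g] g(1) by simp
    then show ?thesis by (simp add: le_max_iff_disj)
  qed (simp add: le_max_iff_disj)
  ultimately show ?thesis by order
qed

end


section \<open>Coordinates on the classes\<close>

lemma transport_translation:
  assumes "order_iso \<phi> Q A" "x \<in> Q"
  shows "transport Q A \<phi> \<psi> (translation Q a) (\<phi> x) = \<psi> (a * x)"
proof -
  have "inj_on \<phi> Q" "\<phi> x \<in> A" using assms by (auto simp: order_iso_def bij_betw_def)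
  then show ?thesis using assms(2) by (simp add: transport_def translation_def)
qed

text \<open>The set of translations automatically becomes the standard one: the coefficient
  \<open>\<alpha> \<ge> 1\<close> stretches \<open>F\<close> so that it covers all translations of the unit interval.\<close>

lemma class_identificationI:
  assumes "order_iso \<phi> Q {0..1}" "1 \<le> \<alpha>" "\<iota> ` F = {0..1}"
    and act: "\<And>f x. f \<in> F \<Longrightarrow> x \<in> Q \<Longrightarrow> \<phi> (f * x) = max (\<phi> x + \<alpha> * (\<iota> f - 1)) 0"
  shows "class_identification F \<iota> Q \<phi> \<alpha>"
proof -
  let ?tr = "\<lambda>f. transport Q {0..1} \<phi> \<phi> (translation Q f)"
  have formula: "?tr f r = max (r + \<alpha> * (\<iota> f - 1)) 0" if f: "f \<in> F" and r: "r \<in> {0..1}" for f r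
  proof -
    have "r \<in> \<phi> ` Q" using assms(1) r by (simp add: order_iso_def bij_betw_def)
    then obtain x where x: "x \<in> Q" "r = \<phi> x" by blast
    show ?thesis using transport_translation[OF assms(1) x(1), of \<phi> f] act[OF f x(1)] x(2) by simp
  qed
  then have tr: "?tr f = (\<lambda>r\<in>{0..1}. max (r + \<alpha> * (\<iota> f - 1)) 0)" if "f \<in> F" for f
    using that by (auto simp: fun_eq_iff transport_def)
  have "Phi_Luk = transport Q {0..1} \<phi> \<phi> ` translation_set F Q"
  proof (intro subset_antisym subsetI)
    fix h assume "h \<in> Phi_Luk"
    then obtain t where t: "t \<in> {0..1}" "h = (\<lambda>r\<in>{0..1}. max (r + t - 1) 0)"
      by (auto simp: Phi_Luk_def)
    have "1 + (t - 1) / \<alpha> \<in> \<iota> ` F" using t(1) assms(2,3) by (auto simp: field_simps)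
    then obtain f where f: "f \<in> F" "\<iota> f = 1 + (t - 1) / \<alpha>" by force
    then have "h = ?tr f" unfolding tr[OF f(1)] t(2) using assms(2) by (simp add: add_diff_eq)
    then show "h \<in> transport Q {0..1} \<phi> \<phi> ` translation_set F Q"
      using f(1) by (auto simp: translation_set_def)
  next
    fix h assume "h \<in> transport Q {0..1} \<phi> \<phi> ` translation_set F Q"
    then obtain f where f: "f \<in> F" "h = ?tr f" by (auto simp: translation_set_def)
    let ?t = "max (1 + \<alpha> * (\<iota> f - 1)) 0"
    have "\<alpha> * (\<iota> f - 1) \<le> 0" using assms(2,3) f(1) by (auto simp: mult_le_0_iff)
    then have "?t \<in> {0..1}" by auto
    moreover have "h = (\<lambda>r\<in>{0..1}. max (r + ?t - 1) 0)"
      unfolding f(2) tr[OF f(1)] by (auto simp: fun_eq_iff max_def)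
    ultimately show "h \<in> Phi_Luk" unfolding Phi_Luk_def by blast
  qed
  then show ?thesis using assms(1,2) formula
    by (simp add: class_identification_def c_iso_def)
qed

lemma class_identification_mult:
  assumes "class_identification F \<iota> Q \<phi> \<alpha>" "f \<in> F" "x \<in> Q"
  shows "\<phi> (f * x) = max (\<phi> x + \<alpha> * (\<iota> f - 1)) 0"
proof -
  have iso: "order_iso \<phi> Q {0..1}"
    using assms(1) by (simp add: class_identification_def c_iso_def)
  then have "\<phi> x \<in> {0..1}" using assms(3) by (auto simp: order_iso_def bij_betw_def)
  then show ?thesis
    using assms transport_translation[OF iso assms(3), of \<phi> f]
    by (simp add: class_identification_def)
qed

context bounded_archimedean_filter
begin

text \<open>Assigning to \<open>x\<close> its residual maps the orbit of \<open>v\<close> onto the segment \<open>[k, 1]\<close> of \<open>F\<close>; this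
  segment is then stretched to the unit interval. The assumption on \<open>v\<close> excludes the
  one-element orbit, for which \<open>k = 1\<close>.\<close>

lemma ex_class_identification:
  assumes \<iota>: "filter_identification F \<iota>" and v: "v * u \<noteq> v"
  shows "\<exists>\<phi> \<alpha>. class_identification F \<iota> ((\<lambda>f. v * f) ` F) \<phi> \<alpha>"
proof -
  let ?Q = "(\<lambda>f. v * f) ` F" and ?k = "residual v (v * u)"
  let ?\<alpha> = "1 / (1 - \<iota> ?k)" and ?\<phi> = "\<lambda>x. (\<iota> (residual v x) - \<iota> ?k) / (1 - \<iota> ?k)"
  have img: "\<iota> ` F = {0..1}" and \<iota>_le: "f \<in> F \<Longrightarrow> g \<in> F \<Longrightarrow> f \<le> g \<longleftrightarrow> \<iota> f \<le> \<iota> g"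
    and \<iota>1: "\<iota> 1 = 1" and \<iota>_mult: "f \<in> F \<Longrightarrow> g \<in> F \<Longrightarrow> \<iota> (f * g) = max (\<iota> f + \<iota> g - 1) 0"
    for f g
    using \<iota> by (auto simp: filter_identification_def order_iso_def bij_betw_def)
  have \<iota>_range: "0 \<le> \<iota> f" "\<iota> f \<le> 1" if "f \<in> F" for f using img that by auto
  have kF: "?k \<in> F" and vk: "v * ?k = v * u"
    using residual_in[of v "v * u"] mult_residual[of v "v * u"] negative_mult_le(1)[of v u]
    by simp_all
  then have "?k \<noteq> 1" using v by auto
  then have k1: "\<iota> ?k < 1"
    using \<iota>_le[OF one_in kF] \<iota>1 tomonoid_le_one[of ?k] by (auto simp: not_le[symmetric])
  have \<alpha>: "1 \<le> ?\<alpha>" using k1 \<iota>_range[OF kF] by simp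
  have \<phi>: "?\<phi> (v * f) = max (1 + ?\<alpha> * (\<iota> f - 1)) 0" if "f \<in> F" for f
  proof -
    have "\<iota> (max f ?k) = max (\<iota> f) (\<iota> ?k)" using \<iota>_le[OF that kF] by (simp add: max_def)
    moreover have "1 + ?\<alpha> * (\<iota> f - 1) = (\<iota> f - \<iota> ?k) / (1 - \<iota> ?k)"
      using k1 by (simp add: field_simps)
    ultimately show ?thesis
      using k1 unfolding residual_orbit[OF that] by (auto simp: max_def divide_le_0_iff)
  qed
  have Q: "v * u \<le> x" "x \<le> v" if "x \<in> ?Q" for x
    using that u_least negative_mult_le(1) by (auto intro: tomonoid_mult_mono)
  have "?\<phi> x \<le> ?\<phi> y \<longleftrightarrow> x \<le> y" if "x \<in> ?Q" "y \<in> ?Q" for x y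
  proof -
    have F: "residual v x \<in> F" "residual v y \<in> F"
      using Q that by (simp_all add: residual_in)
    have "?\<phi> x \<le> ?\<phi> y \<longleftrightarrow> residual v x \<le> residual v y"
      using k1 by (simp add: divide_le_cancel \<iota>_le[OF F])
    also have "\<dots> \<longleftrightarrow> x \<le> y"
    proof
      assume "residual v x \<le> residual v y"
      then have "v * residual v x \<le> v * residual v y" by (simp add: tomonoid_mult_mono)
      then show "x \<le> y" using Q that by (simp add: mult_residual)
    next
      assume "x \<le> y"
      then show "residual v x \<le> residual v y"
        using residual_greatest[OF Q(1)[OF that(2)] F(1)] residual_le[OF Q(1)[OF that(1)]]
        by simp
    qed
    finally show ?thesis .
  qed
  moreover from this have "inj_on ?\<phi> ?Q" by (intro inj_onI) (metis antisym order_refl)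
  moreover have "?\<phi> ` ?Q = {0..1}"
  proof (intro subset_antisym subsetI)
    fix y assume "y \<in> ?\<phi> ` ?Q"
    then obtain f where f: "f \<in> F" "y = max (1 + ?\<alpha> * (\<iota> f - 1)) 0" using \<phi> by auto
    have "?\<alpha> * (\<iota> f - 1) \<le> 0" using k1 \<iota>_range[OF f(1)] by (intro mult_nonneg_nonpos) auto
    then show "y \<in> {0..1}" using f(2) by auto
  next
    fix y :: real assume y: "y \<in> {0..1}"
    have "1 + (y - 1) / a \<in> {0..1}" if "1 \<le> a" for a
      using y that by (auto simp: field_simps)
    then have "1 + (y - 1) / ?\<alpha> \<in> \<iota> ` F" unfolding img using \<alpha> by blast
    then obtain f where f: "f \<in> F" "\<iota> f = 1 + (y - 1) / ?\<alpha>" by force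
    then have "?\<phi> (v * f) = y" using \<phi>[OF f(1)] k1 y by simp
    then show "y \<in> ?\<phi> ` ?Q" using f(1) by blast
  qed
  ultimately have iso: "order_iso ?\<phi> ?Q {0..1}" by (simp add: order_iso_def bij_betw_def)
  have "?\<phi> (f * x) = max (?\<phi> x + ?\<alpha> * (\<iota> f - 1)) 0" if f: "f \<in> F" and x: "x \<in> ?Q" for f x
  proof -
    obtain h where h: "h \<in> F" "x = v * h" using x by blast
    have *: "max (1 + a * (max (p + q - 1) 0 - 1)) 0 = max (max (1 + a * (q - 1)) 0 + a * (p - 1)) 0"
      if "1 \<le> a" "0 \<le> p" "p \<le> 1" "0 \<le> q" "q \<le> 1" for a p q :: real
    proof -
      define s t where "s = a * (p - 1)" and "t = a * (q - 1)"
      have s: "s \<le> 0" unfolding s_def using that by (intro mult_nonneg_nonpos) auto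
      have st: "s + t = a * (p + q - 1) - a" by (simp add: s_def t_def algebra_simps)
      show ?thesis
      proof (cases "p + q - 1 \<le> 0")
        case True
        then have "s + t \<le> - a" unfolding st using that(1) by (simp add: mult_nonneg_nonpos)
        then show ?thesis using True s that(1) by (simp add: t_def[symmetric] s_def[symmetric] max_def)
      next
        case False
        then have "a * (max (p + q - 1) 0 - 1) = s + t" unfolding st by (simp add: algebra_simps)
        then show ?thesis using s by (simp add: t_def[symmetric] s_def[symmetric] max_def)
      qed
    qed
    have "f * x = v * (f * h)" using h by (simp add: mult_ac)
    then show ?thesis
      using \<phi>[OF mult_in[OF f h(1)]] \<phi>[OF h(1)] \<iota>_mult[OF f h(1)] h(2)
        *[OF \<alpha> \<iota>_range[OF f] \<iota>_range[OF h(1)]] by simp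
  qed
  then show ?thesis using class_identificationI[OF iso \<alpha> img] by blast
qed

lemma lukasiewicz_class:
  assumes "Q \<in> filter_quotient F" "class_identification F \<iota> Q \<phi> \<alpha>"
  shows "lukasiewicz Q (translation_set F Q)"
proof -
  have closed: "f * x \<in> Q" if "f \<in> F" "x \<in> Q" for f x
    using class_mult_closed[OF assms(1) that] .
  have "compose Q (translation Q f) (translation Q g) = translation Q (f * g)"
    if "f \<in> F" "g \<in> F" for f g
    using closed that by (auto simp: fun_eq_iff compose_def translation_def mult.assoc)
  moreover have "(\<lambda>x\<in>Q. x) \<in> translation Q ` F"
    using one_in by (intro image_eqI[of _ _ 1]) (auto simp: translation_def)
  moreover have "(\<forall>x\<in>Q. f * x \<le> g * x) \<or> (\<forall>x\<in>Q. g * x \<le> f * x)" for f g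
    by (meson linear order_refl tomonoid_mult_mono)
  ultimately have "composition_tomonoid Q (translation_set F Q)"
    using closed mult_in one_in
    unfolding composition_tomonoid_def translation_set_def
    by (auto simp: translation_def mono_on_def intro: tomonoid_mult_mono)
  then show ?thesis
    using assms(2) by (auto simp: lukasiewicz_def class_identification_def)
qed

text \<open>A translation by \<open>w\<close> commutes with the action of \<open>F\<close>. As \<open>F\<close> carries the top of \<open>R\<close> to
  every element of \<open>R\<close>, the translation is determined by the image \<open>p\<close> of the top, and it
  is affine with slope \<open>\<alpha>\<^sub>S / \<alpha>\<^sub>R\<close> up to truncation at \<open>0\<close>.\<close>

lemma translation_affine:
  assumes \<iota>: "filter_identification F \<iota>"
    and R: "R \<in> filter_quotient F" "class_identification F \<iota> R \<phi>\<^sub>R \<alpha>\<^sub>R"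
    and S: "class_identification F \<iota> S \<phi>\<^sub>S \<alpha>\<^sub>S"
    and w: "\<And>x. x \<in> R \<Longrightarrow> w * x \<in> S"
  shows "\<exists>m \<in> {- (\<alpha>\<^sub>S / \<alpha>\<^sub>R) .. min (1 - \<alpha>\<^sub>S / \<alpha>\<^sub>R) 0}.
    \<forall>x\<in>R. \<phi>\<^sub>S (w * x) = max (\<alpha>\<^sub>S / \<alpha>\<^sub>R * \<phi>\<^sub>R x + m) 0"
proof -
  have img: "\<iota> ` F = {0..1}" and \<iota>_le: "f \<in> F \<Longrightarrow> g \<in> F \<Longrightarrow> f \<le> g \<longleftrightarrow> \<iota> f \<le> \<iota> g" for f g
    using \<iota> by (auto simp: filter_identification_def order_iso_def bij_betw_def)
  have bR: "bij_betw \<phi>\<^sub>R R {0..1}" and bS: "bij_betw \<phi>\<^sub>S S {0..1}" and \<alpha>: "1 \<le> \<alpha>\<^sub>R" "1 \<le> \<alpha>\<^sub>S"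
    using R(2) S by (auto simp: class_identification_def c_iso_def order_iso_def)
  have "\<iota> u = 0"
  proof -
    have "0 \<in> \<iota> ` F" using img by simp
    then obtain f where "f \<in> F" "\<iota> f = 0" by force
    then show ?thesis using \<iota>_le[OF u_in, of f] u_least img u_in by force
  qed
  then have bottom: "\<phi> (u * x) = 0"
    if "class_identification F \<iota> Q \<phi> \<alpha>" "x \<in> Q" for Q \<phi> \<alpha> x
  proof -
    have "\<phi> x \<le> 1" "1 \<le> \<alpha>"
      using that by (auto simp: class_identification_def c_iso_def order_iso_def bij_betw_def)
    then show ?thesis using class_identification_mult[OF that(1) u_in that(2)] \<open>\<iota> u = 0\<close> by simp
  qed
  have "1 \<in> \<phi>\<^sub>R ` R" using bR by (simp add: bij_betw_def)
  then obtain v where v: "v \<in> R" "\<phi>\<^sub>R v = 1" by force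
  define \<beta> p where "\<beta> = \<alpha>\<^sub>S / \<alpha>\<^sub>R" and "p = \<phi>\<^sub>S (w * v)"
  have p: "0 \<le> p" "p \<le> 1" using w[OF v(1)] bS by (auto simp: p_def bij_betw_def)
  have affine: "\<phi>\<^sub>S (w * x) = max (\<beta> * \<phi>\<^sub>R x + (p - \<beta>)) 0" if x: "x \<in> R" for x
  proof -
    have r: "\<phi>\<^sub>R x \<in> {0..1}" using x bR by (auto simp: bij_betw_def)
    then have "1 - (1 - \<phi>\<^sub>R x) / \<alpha>\<^sub>R \<in> \<iota> ` F" using img \<alpha> by (auto simp: field_simps)
    then obtain f where f: "f \<in> F" "\<iota> f = 1 - (1 - \<phi>\<^sub>R x) / \<alpha>\<^sub>R" by force
    have "\<phi>\<^sub>R (f * v) = \<phi>\<^sub>R x"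
      using class_identification_mult[OF R(2) f(1) v(1)] f(2) v(2) \<alpha> r by simp
    then have "f * v = x"
      using bR class_mult_closed[OF R(1) f(1) v(1)] x by (auto simp: bij_betw_def inj_on_def)
    then have "w * x = f * (w * v)" by (metis mult.left_commute)
    then have "\<phi>\<^sub>S (w * x) = \<phi>\<^sub>S (f * (w * v))" by simp
    also have "\<dots> = max (p + \<alpha>\<^sub>S * (\<iota> f - 1)) 0"
      using class_identification_mult[OF S f(1) w[OF v(1)]] by (simp add: p_def)
    also have "p + \<alpha>\<^sub>S * (\<iota> f - 1) = \<beta> * \<phi>\<^sub>R x + (p - \<beta>)"
      using \<alpha> by (simp add: f(2) \<beta>_def field_simps)
    finally show ?thesis .
  qed
  \<comment> \<open>The translation maps the bottom of \<open>R\<close> to the bottom of \<open>S\<close>.\<close>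
  have "\<phi>\<^sub>S (w * (u * v)) = 0" using bottom[OF S w[OF v(1)]] by (simp add: mult_ac)
  then have "p - \<beta> \<le> 0"
    using affine[OF class_mult_closed[OF R(1) u_in v(1)]] bottom[OF R(2) v(1)] by simp
  then show ?thesis using p affine by (intro bexI[of _ "p - \<beta>"]) (auto simp: \<beta>_def)
qed

lemma translations_between_classes:
  assumes \<iota>: "filter_identification F \<iota>"
    and R: "R \<in> filter_quotient F" "class_identification F \<iota> R \<phi>\<^sub>R \<alpha>\<^sub>R"
    and S: "class_identification F \<iota> S \<phi>\<^sub>S \<alpha>\<^sub>S"
    and T: "T \<in> filter_quotient F"
    and RT: "\<And>x t. x \<in> R \<Longrightarrow> t \<in> T \<Longrightarrow> t * x \<in> S"
  shows "\<exists>m \<in> {- (\<alpha>\<^sub>S / \<alpha>\<^sub>R) .. min (1 - \<alpha>\<^sub>S / \<alpha>\<^sub>R) 0}.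
    transport R {0..1} \<phi>\<^sub>R \<phi>\<^sub>S ` translation_set T R =
      {(\<lambda>r\<in>{0..1}. max ((\<alpha>\<^sub>S / \<alpha>\<^sub>R) * r + z) 0) | z. - (\<alpha>\<^sub>S / \<alpha>\<^sub>R) \<le> z \<and> z \<le> m}"
proof -
  let ?tr = "\<lambda>t. transport R {0..1} \<phi>\<^sub>R \<phi>\<^sub>S (translation R t)"
  define \<beta> where "\<beta> = \<alpha>\<^sub>S / \<alpha>\<^sub>R"
  let ?aff = "\<lambda>z. \<lambda>r\<in>{0..1}. max (\<beta> * r + z) 0"
  obtain w where Tw: "T = (\<lambda>f. w * f) ` F" using class_eq_orbit[OF T] by blast
  have wT: "w \<in> T" using Tw one_in by force
  obtain m where m: "m \<in> {- \<beta> .. min (1 - \<beta>) 0}"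
    and w: "x \<in> R \<Longrightarrow> \<phi>\<^sub>S (w * x) = max (\<beta> * \<phi>\<^sub>R x + m) 0" for x
    using translation_affine[OF \<iota> R S RT[OF _ wT]] unfolding \<beta>_def by blast
  have img: "\<iota> ` F = {0..1}"
    using \<iota> by (auto simp: filter_identification_def order_iso_def bij_betw_def)
  have iso: "order_iso \<phi>\<^sub>R R {0..1}" and \<alpha>: "1 \<le> \<alpha>\<^sub>R" "1 \<le> \<alpha>\<^sub>S"
    using R(2) S by (auto simp: class_identification_def c_iso_def)
  then have \<beta>: "0 < \<beta>" by (simp add: \<beta>_def)
  have tr: "?tr (w * f) = ?aff (m + \<alpha>\<^sub>S * (\<iota> f - 1))" if f: "f \<in> F" for f
  proof -
    have c: "\<alpha>\<^sub>S * (\<iota> f - 1) \<le> 0" using \<alpha> img f by (intro mult_nonneg_nonpos) auto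
    have "?tr (w * f) r = max (\<beta> * r + (m + \<alpha>\<^sub>S * (\<iota> f - 1))) 0" if r: "r \<in> {0..1}" for r
    proof -
      have "r \<in> \<phi>\<^sub>R ` R" using iso r by (simp add: order_iso_def bij_betw_def)
      then obtain x where x: "x \<in> R" "r = \<phi>\<^sub>R x" by blast
      have "?tr (w * f) r = \<phi>\<^sub>S (f * (w * x))"
        using transport_translation[OF iso x(1), of \<phi>\<^sub>S "w * f"] x(2) by (simp add: mult_ac)
      also have "\<dots> = max (max (\<beta> * r + m) 0 + \<alpha>\<^sub>S * (\<iota> f - 1)) 0"
        using class_identification_mult[OF S f RT[OF x(1) wT]] w[OF x(1)] x(2) by simp
      finally show ?thesis using c by (simp add: max_def)
    qed
    then show ?thesis by (auto simp: fun_eq_iff transport_def)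
  qed
  have "transport R {0..1} \<phi>\<^sub>R \<phi>\<^sub>S ` translation_set T R = {?aff z | z. - \<beta> \<le> z \<and> z \<le> m}"
  proof (intro subset_antisym subsetI)
    fix h assume "h \<in> transport R {0..1} \<phi>\<^sub>R \<phi>\<^sub>S ` translation_set T R"
    then obtain f where f: "f \<in> F" "h = ?tr (w * f)" by (auto simp: translation_set_def Tw)
    let ?z = "m + \<alpha>\<^sub>S * (\<iota> f - 1)"
    have c: "\<alpha>\<^sub>S * (\<iota> f - 1) \<le> 0" using \<alpha> img f by (intro mult_nonneg_nonpos) auto
    \<comment> \<open>All parameters below \<open>- \<beta>\<close> yield the same map as \<open>- \<beta>\<close>, the constant \<open>0\<close>.\<close>
    have "?aff ?z = ?aff (max ?z (- \<beta>))"
    proof (rule restrict_ext)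
      fix r :: real assume "r \<in> {0..1}"
      then have "\<beta> * r \<le> \<beta>" using \<beta> by (simp add: mult_le_cancel_left1)
      then show "max (\<beta> * r + ?z) 0 = max (\<beta> * r + max ?z (- \<beta>)) 0" by (simp add: max_def)
    qed
    then show "h \<in> {?aff z | z. - \<beta> \<le> z \<and> z \<le> m}"
      using tr[OF f(1)] f(2) c m by (auto intro!: exI[of _ "max ?z (- \<beta>)"])
  next
    fix h assume "h \<in> {?aff z | z. - \<beta> \<le> z \<and> z \<le> m}"
    then obtain z where z: "h = ?aff z" "- \<beta> \<le> z" "z \<le> m" by blast
    have "0 \<le> 1 + (z - m) / \<alpha>\<^sub>S" "1 + (z - m) / \<alpha>\<^sub>S \<le> 1"
      using z m \<alpha> by (auto simp: field_simps)
    then have "1 + (z - m) / \<alpha>\<^sub>S \<in> \<iota> ` F" using img by simp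
    then obtain f where f: "f \<in> F" "\<iota> f = 1 + (z - m) / \<alpha>\<^sub>S" by force
    then have "h = ?tr (w * f)" using tr[OF f(1)] z(1) \<alpha> by simp
    then show "h \<in> transport R {0..1} \<phi>\<^sub>R \<phi>\<^sub>S ` translation_set T R"
      using f(1) by (auto simp: translation_set_def Tw)
  qed
  then show ?thesis using m unfolding \<beta>_def by blast
qed

end


section \<open>The translations between two classes\<close>

lemma real_interval_dense:
  assumes "real_interval I" "x \<in> I" "y \<in> I" "x < y"
  shows "(x + y) / 2 \<in> I"
  using assms unfolding real_interval_def by auto

lemma order_isomorphic_real_interval_dense:
  assumes "order_isomorphic A I" "real_interval I" "a \<in> A" "b \<in> A" "a < b"
  shows "\<exists>c. a < c \<and> c < b"
proof -
  obtain \<phi> where \<phi>: "bij_betw \<phi> A I" "\<forall>x\<in>A. \<forall>y\<in>A. x \<le> y \<longleftrightarrow> \<phi> x \<le> \<phi> y"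
    using assms(1) by (auto simp: order_isomorphic_def order_iso_def)
  have "\<phi> a < \<phi> b" using \<phi>(2) assms by (meson less_le_not_le)
  then have "(\<phi> a + \<phi> b) / 2 \<in> I"
    using real_interval_dense[OF assms(2)] \<phi>(1) assms by (auto simp: bij_betw_def)
  then obtain c where "c \<in> A" "\<phi> c = (\<phi> a + \<phi> b) / 2" using \<phi>(1) by (force simp: bij_betw_def)
  then have "\<phi> a < \<phi> c" "\<phi> c < \<phi> b" using \<open>\<phi> a < \<phi> b\<close> by auto
  then show ?thesis using \<phi>(2) assms \<open>c \<in> A\<close> by (meson less_le_not_le)
qed

lemma filter_in_quotient:
  fixes F :: "'a::qnc_tomonoid set"
  assumes "tomonoid_filter F"
  shows "F \<in> filter_quotient F"
proof -
  have "b \<in> filter_cong F `` {1} \<longleftrightarrow> b \<in> F" for b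
    using assms tomonoid_le_one[of b]
    by (auto simp: filter_cong_def tomonoid_filter_def)
  then have "F = filter_cong F `` {1}" by blast
  then show ?thesis unfolding filter_quotient_def by (metis UNIV_I quotientI)
qed

theorem theorem4p11:
  fixes F R T S :: "'a::qnc_tomonoid set"
  assumes "(UNIV :: 'a set) \<noteq> {1}"
    and "tomonoid_filter F" and "F \<noteq> {1}" and "archimedean F"
    and "\<forall>Q\<in>filter_quotient F. \<exists>I. real_interval I \<and> order_isomorphic Q I"
    and "\<exists>u\<in>F. \<forall>f\<in>F. u \<le> f"
    and "R \<in> filter_quotient F" and "T \<in> filter_quotient F"
    and "quot_less T F"
    and "maximal_pair F R T"
    and "S = quot_mult F R T"
    and "\<not> is_singleton R" and "\<not> is_singleton S"
  shows "lukasiewicz R (translation_set F R) \<and> lukasiewicz S (translation_set F S) \<and>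
    (\<exists>\<iota> \<phi>\<^sub>R \<phi>\<^sub>S \<alpha>\<^sub>R \<alpha>\<^sub>S. filter_identification F \<iota> \<and>
        class_identification F \<iota> R \<phi>\<^sub>R \<alpha>\<^sub>R \<and> class_identification F \<iota> S \<phi>\<^sub>S \<alpha>\<^sub>S) \<and>
    (\<forall>\<iota> \<phi>\<^sub>R \<phi>\<^sub>S \<alpha>\<^sub>R \<alpha>\<^sub>S. filter_identification F \<iota> \<and>
        class_identification F \<iota> R \<phi>\<^sub>R \<alpha>\<^sub>R \<and> class_identification F \<iota> S \<phi>\<^sub>S \<alpha>\<^sub>S \<longrightarrow>
      (\<exists>m \<in> {- (\<alpha>\<^sub>S / \<alpha>\<^sub>R) .. min (1 - \<alpha>\<^sub>S / \<alpha>\<^sub>R) 0}.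
        transport R {0..1} \<phi>\<^sub>R \<phi>\<^sub>S ` translation_set T R =
          {(\<lambda>r\<in>{0..1}. max ((\<alpha>\<^sub>S / \<alpha>\<^sub>R) * r + z) 0) | z. - (\<alpha>\<^sub>S / \<alpha>\<^sub>R) \<le> z \<and> z \<le> m}))"
proof -
  obtain u where u: "u \<in> F" "\<forall>f\<in>F. u \<le> f" using assms(6) by blast
  have one: "1 \<in> F" using assms(2) by (simp add: tomonoid_filter_def)
  have "u \<noteq> 1"
  proof
    assume "u = 1"
    then have "f = 1" if "f \<in> F" for f using u(2) that tomonoid_le_one[of f] by force
    then show False using assms(3) one by blast
  qed
  then have "u < 1" using tomonoid_le_one[of u] by simp
  obtain I where "real_interval I" "order_isomorphic F I"
    using assms(5) filter_in_quotient[OF assms(2)] by blast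
  then interpret bounded_archimedean_filter F u
    using assms(2,4) u \<open>u < 1\<close> order_isomorphic_real_interval_dense by unfold_locales blast+
  have RT: "t * x * u = r0 * t0 * u"
    if "x \<in> R" "t \<in> T" "r0 \<in> R" "t0 \<in> T" for x t r0 t0
  proof -
    have "x * u = r0 * u" "t * u = t0 * u"
      using that assms(7,8) by (auto simp: filter_quotient_iff)
    then have "(t * u) * (x * u) = (r0 * u) * (t0 * u)" by (simp add: mult.commute)
    moreover have "(a * u) * (b * u) = a * b * u" for a b
    proof -
      have "(a * u) * (b * u) = a * b * (u * u)" by (simp add: mult_ac)
      then show ?thesis using mult_u(1)[OF u_in] by simp
    qed
    ultimately show ?thesis by simp
  qed
  obtain r0 t0 where r0: "r0 \<in> R" "t0 \<in> T" using assms(7,8) by (auto simp: filter_quotient_iff)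
  have "S = {y. y * u = r0 * t0 * u}"
  proof -
    have "(r * t, y) \<in> filter_cong F \<longleftrightarrow> y * u = r0 * t0 * u" if "r \<in> R" "t \<in> T" for r t y
      using RT[OF that r0] by (auto simp: filter_cong_iff mult.commute)
    then show ?thesis unfolding assms(11) quot_mult_def using r0 by blast
  qed
  then have SQ: "S \<in> filter_quotient F" and RTS: "\<And>x t. x \<in> R \<Longrightarrow> t \<in> T \<Longrightarrow> t * x \<in> S"
    using RT[OF _ _ r0] by (blast intro: filter_quotient_iff[THEN iffD2])+
  obtain \<iota> where \<iota>: "filter_identification F \<iota>" using ex_filter_identification by blast
  have ident: "\<exists>\<phi> \<alpha>. class_identification F \<iota> Q \<phi> \<alpha>"
    if Q: "Q \<in> filter_quotient F" "\<not> is_singleton Q" for Q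
  proof -
    obtain v where v: "Q = (\<lambda>f. v * f) ` F" using class_eq_orbit[OF Q(1)] by blast
    have "v * u \<noteq> v"
    proof
      assume "v * u = v"
      then have "v * f = v" if "f \<in> F" for f using mult_u(2)[OF that] by (metis mult.assoc)
      then have "Q = {v}" using v one by auto
      then show False using Q(2) by simp
    qed
    then show ?thesis using ex_class_identification[OF \<iota>] v by blast
  qed
  obtain \<phi>\<^sub>R \<alpha>\<^sub>R \<phi>\<^sub>S \<alpha>\<^sub>S where "class_identification F \<iota> R \<phi>\<^sub>R \<alpha>\<^sub>R" "class_identification F \<iota> S \<phi>\<^sub>S \<alpha>\<^sub>S"
    using ident[OF assms(7,12)] ident[OF SQ assms(13)] by blast
  then show ?thesis
    using \<iota> lukasiewicz_class[OF assms(7)] lukasiewicz_class[OF SQ]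
      translations_between_classes[OF _ assms(7) _ _ assms(8) RTS] by blast
qed

end
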